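(* Let $G$ and $H$ be finite simple graphs. Then the symmetric edge polytopes $\mathcal{P}_G$ and $\mathcal{P}_H$ are unimodularly equivalent if and only if the graphic matroids $\mathcal{M}_G$ and $\mathcal{M}_H$ are isomorphic.
   Context: For a finite simple graph $G$ on vertex set $[m]$, its symmetric edge polytope is $\mathcal{P}_G=\mathrm{conv}\{\pm(\mathbf{e}_i-\mathbf{e}_j) : \{i,j\}\in E(G)\}\subseteq\mathbb{R}^{m}$, where $\mathbf{e}_i$ are standard basis vectors. The graphic matroid $\mathcal{M}_G$ has ground set $E(G)$, with a set of edges independent iff it contains no cycle. Two lattice polytopes (possibly in different ambient spaces $\mathbb{R}^a,\mathbb{R}^b$ and not full-dimensional) are unimodularly equivalent if there is an affine bijection between their affine hulls that maps the lattice points of one affine hull bijectively onto the lattice points of the other and maps one polytope onto the other (for full-dimensional polytopes in $\mathbb{R}^r$: $Q=F(P)+\mathbf{v}$ with $F\in\mathrm{GL}_r(\mathbb{Z})$, $\mathbf{v}\in\mathbb{Z}^r$). *)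

theory Defs
  imports "HOL-Analysis.Analysis"
begin

text \<open>A finite simple graph has a type \<open>'v\<close> of class \<open>finite\<close> as its vertex set and is given by
  its edge set, each edge being a set of two vertices. The ambient space of its symmetric edge
  polytope is \<open>real ^ 'v\<close>.\<close>

definition simple_graph :: "'v::finite set set \<Rightarrow> bool" where
  "simple_graph E \<longleftrightarrow> (\<forall>e\<in>E. card e = 2)"

definition symmetric_edge_polytope :: "'v::finite set set \<Rightarrow> (real ^ 'v) set" where
  "symmetric_edge_polytope E =
     convex hull {x. \<exists>i j. {i, j} \<in> E \<and>
       (x = axis i 1 - axis j 1 \<or> x = - (axis i 1 - axis j 1))}"

definition is_cycle :: "'v set set \<Rightarrow> 'v list \<Rightarrow> bool" where
  "is_cycle X vs \<longleftrightarrow> length vs \<ge> 3 \<and> distinct vs \<and>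
     (\<forall>i < length vs. {vs ! i, vs ! (Suc i mod length vs)} \<in> X)"

record 'a matroid =
  ground :: "'a set"
  indep :: "'a set \<Rightarrow> bool"

definition graphic_matroid :: "'v set set \<Rightarrow> 'v set matroid" where
  "graphic_matroid E =
     \<lparr>ground = E, indep = (\<lambda>X. X \<subseteq> E \<and> \<not> (\<exists>vs. is_cycle X vs))\<rparr>"

definition matroid_isomorphic :: "'a matroid \<Rightarrow> 'b matroid \<Rightarrow> bool" where
  "matroid_isomorphic M N \<longleftrightarrow>
     (\<exists>\<phi>. bij_betw \<phi> (ground M) (ground N) \<and>
       (\<forall>X \<subseteq> ground M. indep M X \<longleftrightarrow> indep N (\<phi> ` X)))"

definition lattice_points :: "(real ^ 'n::finite) set \<Rightarrow> (real ^ 'n) set" where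
  "lattice_points S = {x \<in> S. \<forall>i. x $ i \<in> \<int>}"

definition affine_map_on :: "'a::real_vector set \<Rightarrow> ('a \<Rightarrow> 'b::real_vector) \<Rightarrow> bool" where
  "affine_map_on S f \<longleftrightarrow>
     (\<forall>x\<in>S. \<forall>y\<in>S. \<forall>u v. u + v = 1 \<longrightarrow>
        f (u *\<^sub>R x + v *\<^sub>R y) = u *\<^sub>R f x + v *\<^sub>R f y)"

definition unimodularly_equivalent ::
    "(real ^ 'm::finite) set \<Rightarrow> (real ^ 'n::finite) set \<Rightarrow> bool" where
  "unimodularly_equivalent P Q \<longleftrightarrow>
     (\<exists>f. affine_map_on (affine hull P) f \<and>
          bij_betw f (affine hull P) (affine hull Q) \<and>
          bij_betw f (lattice_points (affine hull P)) (lattice_points (affine hull Q)) \<and>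
          f ` P = Q)"

end

theory Submission
  imports Defs
begin

text \<open>The vertices of the symmetric edge polytope are the arc vectors \<open>axis i 1 - axis j 1\<close>. A set
  of arc vectors, no two of them opposite, is linearly independent iff its edges form a forest, and
  the coordinates with respect to such a set are sums of entries over one side of a cut: they are
  \<open>-1\<close>, \<open>0\<close> or \<open>1\<close> for arc vectors and integral for lattice points. Both conditions of the theorem
  are equivalent to the existence of a linear map that is injective on the span and maps the arc
  vectors of \<open>G\<close> onto those of \<open>H\<close>.

  A unimodular equivalence permutes vertices. As they sum up to \<open>0\<close>, it fixes \<open>0\<close> and is linear.

  For a matroid isomorphism \<open>\<phi>\<close> the linear map exists by the unique representability of regular
  matroids, which is proved by adding one vector at a time. Suppose that \<open>L\<close> is linear and
  \<open>L v = \<plusminus>\<phi> v\<close> on \<open>V\<close>, and let \<open>n\<close> and \<open>n'\<close> in the span of \<open>V\<close> satisfy \<open>L n' = \<phi> n\<close>. With respect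
  to every independent subset of \<open>V\<close> the coordinates of \<open>n\<close> and \<open>n'\<close> agree up to sign, that is,
  \<open>(n + n')/2\<close> and \<open>(n - n')/2\<close> have disjoint supports. By basis exchange, this is only possible if
  these two vectors lie in complementary direct summands, and reversing the second summand takes
  \<open>n\<close> to \<open>n'\<close> and every \<open>v\<close> in \<open>V\<close> to \<open>\<plusminus>v\<close>.\<close>

section \<open>Coordinates with respect to a basis\<close>

lemma independent_spanning_subset:
  fixes V :: "'a::real_vector set"
  obtains B where "B \<subseteq> V" "independent B" "span B = span V"
proof -
  obtain B where "B \<subseteq> V" "independent B" "V \<subseteq> span B" using maximal_independent_subset by blast
  then show thesis using that by (simp add: span_minimal span_mono subset_antisym)
qed

lemma independent_linear_image_iff:
  fixes f :: "'a::real_vector \<Rightarrow> 'b::real_vector"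
  assumes f: "linear f" "inj_on f (span X)"
  shows "independent (f ` X) \<longleftrightarrow> independent X"
proof
  have "\<exists>g. range g \<subseteq> span X \<and> linear g \<and> (\<forall>x\<in>span X. g (f x) = x)"
    by (rule linear_inj_on_left_inverse[OF f])
  then obtain g where g: "linear g" "\<forall>x\<in>span X. g (f x) = x" by metis
  have "inj_on g (span (f ` X))"
    unfolding linear_span_image[OF f(1)] by (rule inj_onI) (use g(2) in auto)
  moreover have "g ` f ` X = X" using g(2) by (force simp: image_image span_base)
  moreover assume "independent (f ` X)"
  ultimately show "independent X" using linear_independent_injective_image[OF g(1)] by metis
qed (rule linear_independent_injective_image[OF f(1) _ f(2)])

lemma representation_nonzeroD:
  assumes "representation B v b \<noteq> 0"
  shows "independent B" "v \<in> span B" "b \<in> B"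
proof -
  show "independent B" "v \<in> span B" using assms by (auto simp: representation_def split: if_splits)
  show "b \<in> B" using assms by (rule representation_ne_zero)
qed

lemma linear_eq_sum_representation:
  assumes "linear f" "independent B" "v \<in> span B"
  shows "f v = (\<Sum>b | representation B v b \<noteq> 0. representation B v b *\<^sub>R f b)"
proof -
  have "f v = f (\<Sum>b | representation B v b \<noteq> 0. representation B v b *\<^sub>R b)"
    using assms(2,3) by (simp add: sum_nonzero_representation_eq)
  then show ?thesis using \<open>linear f\<close> by (simp add: linear_sum linear_scale)
qed

lemma representation_eq_functional:
  assumes "independent B" "b \<in> B" "v \<in> span B"
    and "linear g" "g b = 1" "\<And>x. x \<in> B - {b} \<Longrightarrow> g x = 0"
  shows "representation B v b = g v"
proof -
  let ?S = "{x. representation B v x \<noteq> 0}"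
  have "g v = (\<Sum>x\<in>?S. representation B v x *\<^sub>R g x)"
    by (rule linear_eq_sum_representation) fact+
  also have "\<dots> = (\<Sum>x\<in>?S. if b = x then representation B v b else 0)"
    using assms(5,6) by (intro sum.cong) (auto dest: representation_ne_zero)
  also have "\<dots> = representation B v b" by (simp add: finite_representation)
  finally show ?thesis ..
qed

lemma linear_scales_if_scales_support:
  assumes "linear f" "independent B" "v \<in> span B"
    and "\<And>b. representation B v b \<noteq> 0 \<Longrightarrow> f b = c *\<^sub>R b"
  shows "f v = c *\<^sub>R v"
proof -
  let ?S = "{b. representation B v b \<noteq> 0}"
  have "f v = (\<Sum>b\<in>?S. c *\<^sub>R (representation B v b *\<^sub>R b))"
    unfolding linear_eq_sum_representation[OF assms(1-3)]
    by (intro sum.cong) (simp_all add: assms(4) scaleR_left_commute)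
  also have "\<dots> = c *\<^sub>R (\<Sum>b\<in>?S. representation B v b *\<^sub>R b)" by (rule scaleR_sum_right[symmetric])
  finally show ?thesis using assms(2,3) by (simp add: sum_nonzero_representation_eq)
qed

lemma coordinate_functional:
  fixes B :: "'a::real_vector set"
  assumes "independent B" "b \<in> B"
  obtains g where "linear g" "\<And>x. x \<in> B \<Longrightarrow> g x = (if x = b then 1 else 0)"
    "\<And>v. v \<in> span B \<Longrightarrow> representation B v b = g v"
proof -
  obtain g where g: "linear g" "\<forall>x\<in>B. g x = (if x = b then 1 else 0 :: real)"
    using linear_independent_extend[OF \<open>independent B\<close>, of "\<lambda>x. if x = b then 1 else 0"] by blast
  then show thesis
    using representation_eq_functional[OF assms _ \<open>linear g\<close>] assms(2) that by auto
qed

lemma representation_nonzero_iff: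
  assumes "independent B" "b \<in> B"
  shows "representation B v b \<noteq> 0 \<longleftrightarrow> v \<in> span B \<and> v \<notin> span (B - {b})"
proof safe
  assume nz: "representation B v b \<noteq> 0"
  then show "v \<in> span B" by (rule representation_nonzeroD)
  assume "v \<in> span (B - {b})"
  then have "representation B v b = representation (B - {b}) v b"
    using representation_extend[OF assms(1), of v "B - {b}"] by auto
  with nz show False using representation_ne_zero by fastforce
next
  assume span: "v \<in> span B" "v \<notin> span (B - {b})" and zero: "representation B v b = 0"
  have "(\<Sum>x | representation B v x \<noteq> 0. representation B v x *\<^sub>R x) \<in> span (B - {b})"
    using zero by (intro span_sum span_scale span_base) (auto dest: representation_ne_zero)
  then show False using span assms(1) by (simp add: sum_nonzero_representation_eq)
qed

lemma basis_exchange: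
  fixes T :: "'a::real_vector set"
  assumes T: "independent T" "s \<in> T" and pivot: "representation T c s \<noteq> 0"
  defines "T' \<equiv> insert c (T - {s})"
  shows "independent T'" "span T' = span T"
    and "x \<in> span T \<Longrightarrow> t \<in> T - {s} \<Longrightarrow> representation T' x t =
      representation T x t - representation T c t / representation T c s * representation T x s"
proof -
  have cT: "c \<in> span T" "c \<notin> span (T - {s})"
    using pivot representation_nonzero_iff[OF T] by auto
  have "independent (T - {s})" using T(1) dependent_mono by blast
  then show indep: "independent T'" using cT(2) by (simp add: T'_def independent_insertI)
  have "insert s T' = insert c T" using T(2) by (auto simp: T'_def)
  moreover have "s \<in> span T'" unfolding T'_def by (rule in_span_delete[OF cT])
  ultimately show span: "span T' = span T" using cT(1) span_redundant by metis
  assume x: "x \<in> span T" and t: "t \<in> T - {s}"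
  obtain g where g: "linear g" "\<And>y. y \<in> T \<Longrightarrow> g y = (if y = s then 1 else 0)"
    and g_rep: "\<And>v. v \<in> span T \<Longrightarrow> representation T v s = g v"
    using coordinate_functional T by metis
  obtain h where h: "linear h" "\<And>y. y \<in> T \<Longrightarrow> h y = (if y = t then 1 else 0)"
    and h_rep: "\<And>v. v \<in> span T \<Longrightarrow> representation T v t = h v"
    using coordinate_functional T(1) t by (metis DiffD1)
  let ?k = "\<lambda>v. h v - h c / g c * g v"
  have "representation T' x t = ?k x"
  proof (rule representation_eq_functional[OF indep])
    show "linear ?k"
      using linear_compose_sub[OF h(1)] linear_compose_scale_right[OF g(1), of "h c / g c"] by simp
    show "?k t = 1" using g(2) h(2) t by simp
    show "?k y = 0" if "y \<in> T' - {t}" for y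
      using that g(2) h(2) pivot g_rep[OF cT(1)] by (auto simp: T'_def)
  qed (use t x span in \<open>auto simp: T'_def\<close>)
  then show "representation T' x t =
      representation T x t - representation T c t / representation T c s * representation T x s"
    using g_rep h_rep x cT(1) by simp
qed

section \<open>Linear extensions up to sign\<close>

definition independence_preserving ::
    "('a::real_vector \<Rightarrow> 'b::real_vector) \<Rightarrow> 'a set \<Rightarrow> bool" where
  "independence_preserving \<phi> V \<longleftrightarrow>
     inj_on \<phi> V \<and> (\<forall>X\<subseteq>V. independent (\<phi> ` X) \<longleftrightarrow> independent X)"

lemma independence_preservingD:
  assumes "independence_preserving \<phi> V" "X \<subseteq> V"
  shows "inj_on \<phi> X" "independent (\<phi> ` X) \<longleftrightarrow> independent X"
  using assms inj_on_subset[of \<phi> V X] by (simp_all add: independence_preserving_def)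

lemma independence_preserving_mono:
  "independence_preserving \<phi> V \<Longrightarrow> U \<subseteq> V \<Longrightarrow> independence_preserving \<phi> U"
  using inj_on_subset[of \<phi> V U] by (auto simp: independence_preserving_def)

lemma independence_preserving_in_span_iff:
  assumes "independence_preserving \<phi> V" "T \<subseteq> V" "independent T" "v \<in> V"
  shows "\<phi> v \<in> span (\<phi> ` T) \<longleftrightarrow> v \<in> span T"
proof (cases "v \<in> T")
  case False
  then have "\<phi> v \<notin> \<phi> ` T"
    using independence_preservingD(1)[OF assms(1) order_refl] assms(2,4) by (auto simp: inj_on_def)
  moreover have "independent (\<phi> ` T)" using independence_preservingD(2)[OF assms(1,2)] assms(3) by simp
  moreover have "independent (insert (\<phi> v) (\<phi> ` T)) \<longleftrightarrow> independent (insert v T)"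
    using independence_preservingD(2)[OF assms(1), of "insert v T"] assms(2,4) by simp
  ultimately show ?thesis using False assms(3) by (simp add: independent_insert)
qed (simp add: span_base)

lemma independence_preserving_linear:
  assumes "linear L" "inj_on L (span V)"
  shows "independence_preserving L V"
proof -
  have "inj_on L (span X)" if "X \<subseteq> V" for X
    by (rule inj_on_subset[OF assms(2) span_mono[OF that]])
  moreover have "inj_on L V" by (rule inj_on_subset[OF assms(2) span_superset])
  ultimately show ?thesis
    using independent_linear_image_iff[OF assms(1)] by (simp add: independence_preserving_def)
qed

definition extends_up_to_sign ::
    "('a::real_vector \<Rightarrow> 'b::real_vector) \<Rightarrow> ('a \<Rightarrow> 'b) \<Rightarrow> 'a set \<Rightarrow> bool" where
  "extends_up_to_sign L \<phi> V \<longleftrightarrow> linear L \<and> (\<forall>v\<in>V. L v = \<phi> v \<or> L v = - \<phi> v)"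

lemma extends_up_to_signD:
  assumes "extends_up_to_sign L \<phi> V"
  shows "linear L" "v \<in> V \<Longrightarrow> L v = \<phi> v \<or> L v = - \<phi> v"
  using assms by (simp_all add: extends_up_to_sign_def)

lemma extends_up_to_sign_comp:
  assumes "extends_up_to_sign D (\<lambda>v. v) V" "extends_up_to_sign L \<phi> V"
  shows "extends_up_to_sign (L \<circ> D) \<phi> V"
  unfolding extends_up_to_sign_def
proof (intro conjI ballI)
  note D = extends_up_to_signD[OF assms(1)] and L = extends_up_to_signD[OF assms(2)]
  show "linear (L \<circ> D)" using D(1) L(1) by (rule linear_compose)
  show "(L \<circ> D) v = \<phi> v \<or> (L \<circ> D) v = - \<phi> v" if "v \<in> V" for v
    using D(2)[OF that] L(2)[OF that] linear_neg[OF L(1), of v] by auto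
qed

lemma span_image_extends_up_to_sign:
  assumes "extends_up_to_sign L \<phi> V" "T \<subseteq> V"
  shows "span (\<phi> ` T) = L ` span T"
proof -
  have "L t \<in> span (\<phi> ` T) \<and> \<phi> t \<in> span (L ` T)" if "t \<in> T" for t
  proof -
    have "L t \<in> span (L ` T)" "\<phi> t \<in> span (\<phi> ` T)" using that by (simp_all add: span_base)
    moreover have "L t = \<phi> t \<or> L t = - \<phi> t"
      using extends_up_to_signD(2)[OF assms(1)] assms(2) that by blast
    ultimately show ?thesis by (metis minus_minus span_neg)
  qed
  then have "span (\<phi> ` T) = span (L ` T)" by (auto simp: span_eq)
  then show ?thesis using linear_span_image extends_up_to_signD(1)[OF assms(1)] by metis
qed

lemma abs_representation_extends_up_to_sign:
  assumes L: "extends_up_to_sign L \<phi> V" and \<phi>: "independence_preserving \<phi> V"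
    and T: "T \<subseteq> V" "independent T" "t \<in> T" and x: "x \<in> span T"
  shows "\<bar>representation (\<phi> ` T) (L x) (\<phi> t)\<bar> = \<bar>representation T x t\<bar>"
proof -
  note lin = extends_up_to_signD(1)[OF L]
  have "independent (\<phi> ` T)" using independence_preservingD(2)[OF \<phi> T(1)] T(2) by simp
  then obtain g where g: "linear g" "\<And>y. y \<in> \<phi> ` T \<Longrightarrow> g y = (if y = \<phi> t then 1 else 0)"
    and g_rep: "\<And>v. v \<in> span (\<phi> ` T) \<Longrightarrow> representation (\<phi> ` T) v (\<phi> t) = g v"
    using coordinate_functional imageI[OF T(3)] by metis
  have g_\<phi>: "g (\<phi> s) = (if s = t then 1 else 0)" if "s \<in> T" for s
    using g(2) inj_on_eq_iff[OF independence_preservingD(1)[OF \<phi> T(1)] that T(3)] that by simp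
  have g_L: "g (L s) = g (\<phi> s) \<or> g (L s) = - g (\<phi> s)" if "s \<in> T" for s
    using extends_up_to_signD(2)[OF L subsetD[OF T(1) that]] linear_neg[OF g(1), of "\<phi> s"] by auto
  let ?h = "\<lambda>v. g (L t) * g (L v)"
  have "representation T x t = ?h x"
  proof (rule representation_eq_functional[OF T(2,3) x])
    show "linear ?h"
      using linear_compose_scale_right[OF linear_compose[OF lin g(1)], of "g (L t)"]
      by (simp add: o_def)
    show "?h t = 1" using g_L[of t] g_\<phi>[of t] T(3) by auto
    show "?h s = 0" if "s \<in> T - {t}" for s using g_L[of s] g_\<phi>[of s] that by auto
  qed
  moreover have "\<bar>g (L t)\<bar> = 1" using g_L[of t] g_\<phi>[of t] T(3) by auto
  moreover have "L x \<in> span (\<phi> ` T)" using span_image_extends_up_to_sign[OF L T(1)] x by simp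
  ultimately show ?thesis using g_rep by (simp add: abs_mult)
qed

lemma inj_on_span_extends_up_to_sign:
  assumes L: "extends_up_to_sign L \<phi> V" and \<phi>: "independence_preserving \<phi> V"
  shows "inj_on L (span V)"
proof -
  obtain B where B: "B \<subseteq> V" "independent B" "span B = span V"
    by (rule independent_spanning_subset)
  have "x = 0" if "x \<in> span B" "L x = 0" for x
  proof -
    have "representation B x t = 0" for t
      using abs_representation_extends_up_to_sign[OF L \<phi> B(1,2) _ that(1), of t] that(2)
        representation_ne_zero[of B x t] by (auto simp: representation_zero)
    then show ?thesis using sum_nonzero_representation_eq[OF B(2) that(1)] by simp
  qed
  then show ?thesis
    using linear_inj_on_iff_eq_0[OF extends_up_to_signD(1)[OF L] subspace_span] B(3) by metis
qed

section \<open>Separated vectors\<close>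

definition separated :: "'a::real_vector set \<Rightarrow> 'a \<Rightarrow> 'a \<Rightarrow> bool" where
  "separated V p q \<longleftrightarrow> (\<forall>T\<subseteq>V. \<forall>t. representation T p t = 0 \<or> representation T q t = 0)"

definition coordinate_adjacent :: "'a::real_vector set \<Rightarrow> 'a set \<Rightarrow> 'a \<Rightarrow> 'a \<Rightarrow> bool" where
  "coordinate_adjacent V T s t \<longleftrightarrow>
     (\<exists>c\<in>V. representation T c s \<noteq> 0 \<and> representation T c t \<noteq> 0)"

lemma basis_exchange_representation_unchanged:
  assumes "independent T" "s \<in> T" "representation T c s \<noteq> 0"
    and "representation T x s = 0" "representation T x t \<noteq> 0"
  shows "representation (insert c (T - {s})) x t = representation T x t"
proof -
  have "x \<in> span T" "t \<in> T - {s}" using assms(4,5) representation_nonzeroD[OF assms(5)] by auto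
  then show ?thesis using basis_exchange(3)[OF assms(1-3)] assms(4) by simp
qed

lemma basis_exchange_representation_nonzero:
  assumes "independent T" "s \<in> T" "representation T c s \<noteq> 0" "representation T c t \<noteq> 0"
    and "representation T x s \<noteq> 0" "representation T x t = 0"
  shows "representation (insert c (T - {s})) x t \<noteq> 0"
proof -
  have "t \<in> T - {s}" using assms(5,6) representation_nonzeroD(3)[OF assms(4)] by auto
  then show ?thesis
    using basis_exchange(3)[OF assms(1-3) representation_nonzeroD(2)[OF assms(5)]] assms(3-6) by simp
qed

lemma exchanged_walk_or_shortcut:
  assumes T: "independent T" "s \<in> T" and pivot: "representation T c s \<noteq> 0"
    and "(coordinate_adjacent V T ^^ k) x y"
  shows "(coordinate_adjacent V (insert c (T - {s})) ^^ k) x y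
    \<or> (\<exists>j\<le>k. (coordinate_adjacent V T ^^ j) s y)"
  using assms(4)
proof (induction k arbitrary: x)
  case (Suc k)
  let ?T' = "insert c (T - {s})"
  obtain z where xz: "coordinate_adjacent V T x z" and walk: "(coordinate_adjacent V T ^^ k) z y"
    using Suc.prems by (rule relpowp_Suc_E2)
  obtain d where common: "d \<in> V" "representation T d x \<noteq> 0" "representation T d z \<noteq> 0"
    using xz unfolding coordinate_adjacent_def by blast
  show ?case
  proof (cases "representation T d s = 0")
    case True
    then have "coordinate_adjacent V ?T' x z"
      using common basis_exchange_representation_unchanged[OF T pivot True]
      unfolding coordinate_adjacent_def by metis
    then show ?thesis using Suc.IH[OF walk] by (meson le_SucI relpowp_Suc_I2)
  next
    case False
    then have "coordinate_adjacent V T s z" using common unfolding coordinate_adjacent_def by blast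
    then show ?thesis using walk by (blast intro: relpowp_Suc_I2)
  qed
qed simp

text \<open>Exchanging the start \<open>s\<close> of the walk against the vector along which its first step is taken
  brings the second vertex of the walk into the support of \<open>p\<close>.\<close>

lemma separated_walk_descent:
  assumes sep: "separated V p q" "T \<subseteq> V"
    and nz: "representation T p s \<noteq> 0" "representation T q t \<noteq> 0"
    and walk: "(coordinate_adjacent V T ^^ k) s t"
  obtains T' s' j where "j < k" "T' \<subseteq> V" "representation T' p s' \<noteq> 0"
    "representation T' q t \<noteq> 0" "(coordinate_adjacent V T' ^^ j) s' t"
proof -
  have q_s: "representation T q s = 0" using sep nz(1) unfolding separated_def by blast
  then have "s \<noteq> t" using nz(2) by blast
  then obtain m where k: "k = Suc m" using walk by (cases k) auto
  obtain s' where "coordinate_adjacent V T s s'" and tail: "(coordinate_adjacent V T ^^ m) s' t"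
    using walk unfolding k by (rule relpowp_Suc_E2)
  then obtain c where step: "c \<in> V" "representation T c s \<noteq> 0" "representation T c s' \<noteq> 0"
    unfolding coordinate_adjacent_def by blast
  note T = representation_nonzeroD(1,3)[OF nz(1)]
  let ?T' = "insert c (T - {s})"
  consider (inside) "representation T p s' \<noteq> 0"
    | (shortcut) j where "j < k" "(coordinate_adjacent V T ^^ j) s t"
    | (exchanged) "representation T p s' = 0" "(coordinate_adjacent V ?T' ^^ m) s' t"
    using exchanged_walk_or_shortcut[OF T step(2) tail] k by (metis le_imp_less_Suc)
  then show thesis
  proof cases
    case inside
    then show thesis using that[of m T s'] sep(2) nz(2) tail k by simp
  next
    case shortcut
    then show thesis using that[of j T s] sep(2) nz by blast
  next
    case exchanged
    have "representation ?T' p s' \<noteq> 0"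
      by (rule basis_exchange_representation_nonzero[OF T step(2,3) nz(1) exchanged(1)])
    moreover have "representation ?T' q t \<noteq> 0"
      using basis_exchange_representation_unchanged[OF T step(2) q_s nz(2)] nz(2) by simp
    ultimately show thesis using that[of m ?T' s'] exchanged(2) step(1) sep(2) k by auto
  qed
qed

lemma separated_imp_not_connected:
  assumes sep: "separated V p q"
    and "T \<subseteq> V" "representation T p s \<noteq> 0" "(coordinate_adjacent V T ^^ k) s t"
  shows "representation T q t = 0"
  using assms(2-)
proof (induction k arbitrary: T s rule: less_induct)
  case (less k)
  show ?case
  proof (rule ccontr)
    assume "representation T q t \<noteq> 0"
    with sep less.prems(1,2) obtain T' s' j where "j < k" "T' \<subseteq> V" "representation T' p s' \<noteq> 0"
      "representation T' q t \<noteq> 0" "(coordinate_adjacent V T' ^^ j) s' t"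
      using less.prems(3) by (rule separated_walk_descent)
    then show False using less.IH by blast
  qed
qed

lemma separated_reflection:
  fixes V :: "'a::real_vector set"
  assumes sep: "separated V p q" and "p \<in> span V" "q \<in> span V"
  obtains D where "extends_up_to_sign D (\<lambda>v. v) V" "D p = p" "D q = - q"
proof -
  obtain T where T: "T \<subseteq> V" "independent T" "span T = span V"
    by (rule independent_spanning_subset)
  define R where "R = {t. \<exists>s. representation T p s \<noteq> 0 \<and> (coordinate_adjacent V T)\<^sup>*\<^sup>* s t}"
  obtain D where D: "linear D" "\<forall>t\<in>T. D t = (if t \<in> R then t else - t)"
    using linear_independent_extend[OF T(2), of "\<lambda>t. if t \<in> R then t else - t"] by blast
  have D_id: "D x = x" if "x \<in> span V" "\<And>t. representation T x t \<noteq> 0 \<Longrightarrow> t \<in> R" for x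
    using linear_scales_if_scales_support[OF D(1) T(2), of x 1] D(2) that
      representation_nonzeroD(3)[of T x] by (auto simp: T(3))
  have D_neg: "D x = - x" if "x \<in> span V" "\<And>t. representation T x t \<noteq> 0 \<Longrightarrow> t \<notin> R" for x
    using linear_scales_if_scales_support[OF D(1) T(2), of x "-1"] D(2) that
      representation_nonzeroD(3)[of T x] by (auto simp: T(3))
  have "D v = v \<or> D v = - v" if "v \<in> V" for v
  proof -
    have "t \<in> R" if "representation T v s \<noteq> 0" "s \<in> R" "representation T v t \<noteq> 0" for s t
    proof -
      have "coordinate_adjacent V T s t"
        using that(1,3) \<open>v \<in> V\<close> unfolding coordinate_adjacent_def by blast
      then show ?thesis
        using that(2) unfolding R_def by (blast intro: rtranclp.rtrancl_into_rtrancl)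
    qed
    then show ?thesis using D_id D_neg span_base[OF that] by metis
  qed
  then have "extends_up_to_sign D (\<lambda>v. v) V" using D(1) by (simp add: extends_up_to_sign_def)
  moreover have "D p = p" using D_id[OF assms(2)] by (auto simp: R_def)
  moreover have "D q = - q"
    using D_neg[OF assms(3)] separated_imp_not_connected[OF sep T(1)]
    by (auto simp: R_def dest: rtranclp_imp_relpowp)
  ultimately show thesis by (rule that)
qed

lemma reflection_if_equal_abs_representations:
  fixes V :: "'a::real_vector set"
  assumes n: "n \<in> span V" "n' \<in> span V"
    and abs: "\<And>T t. T \<subseteq> V \<Longrightarrow> \<bar>representation T n t\<bar> = \<bar>representation T n' t\<bar>"
  obtains D where "extends_up_to_sign D (\<lambda>v. v) V" "D n = n'"
proof -
  let ?p = "(1/2) *\<^sub>R (n + n')" and ?q = "(1/2) *\<^sub>R (n - n')"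
  have n_eq: "n = ?p + ?q" "n' = ?p - ?q"
    by (simp_all add: algebra_simps flip: scaleR_left_distrib)
  have "representation T ?p t = 0 \<or> representation T ?q t = 0" if "T \<subseteq> V" for T t
  proof (rule ccontr)
    assume nz: "\<not> ?thesis"
    then have T: "independent T" and "?p \<in> span T" "?q \<in> span T"
      using representation_nonzeroD by blast+
    then have "n \<in> span T" "n' \<in> span T" using n_eq span_add span_diff by metis+
    then show False
      using nz abs[OF that, of t]
      by (auto simp: representation_scale[OF T] representation_add[OF T] representation_diff[OF T]
          span_add span_diff abs_eq_iff)
  qed
  then have "separated V ?p ?q" by (simp add: separated_def)
  moreover have "?p \<in> span V" "?q \<in> span V"
    using n by (simp_all add: span_add span_diff span_scale)
  ultimately obtain D where D: "extends_up_to_sign D (\<lambda>v. v) V" "D ?p = ?p" "D ?q = - ?q"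
    by (rule separated_reflection)
  have "D n = D ?p + D ?q" using n_eq(1) linear_add[OF extends_up_to_signD(1)[OF D(1)]] by metis
  then have "D n = n'" using D(2,3) n_eq(2) by simp
  with D(1) show thesis by (rule that)
qed

section \<open>Unimodular systems of vectors\<close>

definition unimodular :: "'a::real_vector set \<Rightarrow> bool" where
  "unimodular V \<longleftrightarrow> (\<forall>T\<subseteq>V. \<forall>v\<in>V. \<forall>t. representation T v t \<in> {-1, 0, 1})"

lemma unimodular_mono: "unimodular V \<Longrightarrow> U \<subseteq> V \<Longrightarrow> unimodular U"
  unfolding unimodular_def by blast

lemma unimodular_abs_representation:
  assumes "unimodular V" "T \<subseteq> V" "v \<in> V"
  shows "\<bar>representation T v t\<bar> = (if representation T v t = 0 then 0 else 1)"
proof -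
  have "representation T v t \<in> {-1, 0, 1}" using assms unfolding unimodular_def by blast
  then show ?thesis by auto
qed

lemma unimodular_abs_representation_image:
  assumes "unimodular V" "unimodular (\<phi> ` V)" and \<phi>: "independence_preserving \<phi> V"
    and "T \<subseteq> V" "independent T" "t \<in> T" "v \<in> V"
  shows "\<bar>representation (\<phi> ` T) (\<phi> v) (\<phi> t)\<bar> = \<bar>representation T v t\<bar>"
proof -
  have "\<phi> ` (T - {t}) = \<phi> ` T - {\<phi> t}"
    using inj_on_image_set_diff[OF independence_preservingD(1)[OF \<phi> \<open>T \<subseteq> V\<close>], of T "{t}"] \<open>t \<in> T\<close> by simp
  moreover have "independent (T - {t})" using \<open>independent T\<close> dependent_mono by blast
  moreover have "independent (\<phi> ` T)"
    using independence_preservingD(2)[OF \<phi>] assms(4,5) by blast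
  ultimately have "representation (\<phi> ` T) (\<phi> v) (\<phi> t) \<noteq> 0 \<longleftrightarrow> representation T v t \<noteq> 0"
    using independence_preserving_in_span_iff[OF \<phi> _ _ \<open>v \<in> V\<close>, of T] independence_preserving_in_span_iff[OF \<phi> _ _ \<open>v \<in> V\<close>, of "T - {t}"]
      assms(4-6) by (auto simp: representation_nonzero_iff)
  then show ?thesis
    using assms unimodular_abs_representation[of V] unimodular_abs_representation[of "\<phi> ` V"]
    by (simp add: image_mono)
qed

lemma unimodular_abs_representation_preimage:
  assumes uni: "unimodular (insert n V)" "unimodular (\<phi> ` insert n V)"
    and \<phi>: "independence_preserving \<phi> (insert n V)" and L: "extends_up_to_sign L \<phi> V"
    and n': "n' \<in> span V" "L n' = \<phi> n" and T: "T \<subseteq> V"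
  shows "\<bar>representation T n t\<bar> = \<bar>representation T n' t\<bar>"
proof (cases "independent T \<and> t \<in> T")
  case True
  have \<phi>_V: "independence_preserving \<phi> V" by (rule independence_preserving_mono[OF \<phi>]) blast
  have "n' \<in> span T \<longleftrightarrow> L n' \<in> L ` span T"
    using inj_on_image_mem_iff[OF inj_on_span_extends_up_to_sign[OF L \<phi>_V] n'(1) span_mono[OF T]]
    by simp
  also have "\<dots> \<longleftrightarrow> n \<in> span T"
    using independence_preserving_in_span_iff[OF \<phi>, of T n] True T n'(2) span_image_extends_up_to_sign[OF L T] by auto
  finally have span: "n' \<in> span T \<longleftrightarrow> n \<in> span T" .
  show ?thesis
  proof (cases "n \<in> span T")
    case n_span: True
    have "\<bar>representation T n t\<bar> = \<bar>representation (\<phi> ` T) (L n') (\<phi> t)\<bar>"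
      unfolding n'(2)
      by (rule unimodular_abs_representation_image[OF uni \<phi>, symmetric]) (use True T in auto)
    also have "\<dots> = \<bar>representation T n' t\<bar>"
      using abs_representation_extends_up_to_sign[OF L \<phi>_V T] True n_span span by blast
    finally show ?thesis .
  qed (use span in \<open>simp add: representation_def\<close>)
next
  case False
  then have "representation T x t = 0" for x using representation_nonzeroD[of T x t] by blast
  then show ?thesis by simp
qed

lemma extends_up_to_sign_insert_if_in_span:
  fixes V :: "'a::real_vector set" and \<phi> :: "'a \<Rightarrow> 'b::real_vector"
  assumes uni: "unimodular (insert n V)" "unimodular (\<phi> ` insert n V)"
    and \<phi>: "independence_preserving \<phi> (insert n V)" and L: "extends_up_to_sign L \<phi> V"
    and n: "n \<in> span V"
  shows "\<exists>M. extends_up_to_sign M \<phi> (insert n V)"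
proof -
  obtain B where B: "B \<subseteq> V" "independent B" "span B = span V"
    by (rule independent_spanning_subset)
  have "\<phi> n \<in> span (\<phi> ` B)" using independence_preserving_in_span_iff[OF \<phi>, of B n] B n by auto
  then obtain n' where n': "n' \<in> span V" "L n' = \<phi> n"
    using span_image_extends_up_to_sign[OF L B(1)] B(3) by auto
  note abs_eq = unimodular_abs_representation_preimage[OF uni \<phi> L n']
  obtain D where D: "extends_up_to_sign D (\<lambda>v. v) V" "D n = n'"
    using reflection_if_equal_abs_representations[OF n n'(1) abs_eq] by blast
  have "(L \<circ> D) n = \<phi> n" using D(2) n'(2) by simp
  then have "extends_up_to_sign (L \<circ> D) \<phi> (insert n V)"
    using extends_up_to_sign_comp[OF D(1) L] by (simp add: extends_up_to_sign_def)
  then show ?thesis by (intro exI)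
qed

lemma extends_up_to_sign_insert_if_notin_span:
  fixes V :: "'a::real_vector set" and \<phi> :: "'a \<Rightarrow> 'b::real_vector"
  assumes L: "extends_up_to_sign L \<phi> V" and n: "n \<notin> span V"
  shows "\<exists>M. extends_up_to_sign M \<phi> (insert n V)"
proof -
  obtain B where B: "B \<subseteq> V" "independent B" "span B = span V"
    by (rule independent_spanning_subset)
  have "independent (insert n B)" using n B(2,3) by (simp add: independent_insertI)
  then obtain M where M: "linear M" "\<forall>b\<in>insert n B. M b = (if b = n then \<phi> n else L b)"
    using linear_independent_extend[of _ "\<lambda>b. if b = n then \<phi> n else L b"] by blast
  have "n \<notin> B" using n B(1) by (auto intro: span_base)
  have "M v = L v" if "v \<in> V" for v
    by (rule linear_eq_on_span[OF M(1) extends_up_to_signD(1)[OF L], of B])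
      (use that M(2) B(3) \<open>n \<notin> B\<close> in \<open>auto intro: span_base\<close>)
  then have "extends_up_to_sign M \<phi> (insert n V)"
    using M extends_up_to_signD(2)[OF L] by (simp add: extends_up_to_sign_def)
  then show ?thesis by (intro exI)
qed

theorem unimodular_unique_representation:
  fixes V :: "'a::real_vector set" and \<phi> :: "'a \<Rightarrow> 'b::real_vector"
  assumes "finite V" "unimodular V" "unimodular (\<phi> ` V)" "independence_preserving \<phi> V"
  shows "\<exists>L. extends_up_to_sign L \<phi> V"
  using assms
proof (induction V)
  case empty
  have "extends_up_to_sign (\<lambda>_. 0) \<phi> {}" by (simp add: extends_up_to_sign_def module_hom_zero)
  then show ?case by (intro exI)
next
  case (insert n V)
  have "unimodular V" by (rule unimodular_mono[OF insert.prems(1)]) blast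
  moreover have "unimodular (\<phi> ` V)" by (rule unimodular_mono[OF insert.prems(2)]) blast
  moreover have "independence_preserving \<phi> V"
    by (rule independence_preserving_mono[OF insert.prems(3)]) blast
  ultimately have "\<exists>L. extends_up_to_sign L \<phi> V" by (rule insert.IH)
  then obtain L where L: "extends_up_to_sign L \<phi> V" by (elim exE)
  show ?case
  proof (cases "n \<in> span V")
    case True
    show ?thesis by (rule extends_up_to_sign_insert_if_in_span[OF insert.prems L True])
  next
    case False
    show ?thesis by (rule extends_up_to_sign_insert_if_notin_span[OF L False])
  qed
qed

section \<open>Cycles and arc vectors\<close>

abbreviation connected_by :: "'v set set \<Rightarrow> 'v \<Rightarrow> 'v \<Rightarrow> bool" where
  "connected_by X \<equiv> (\<lambda>i j. {i, j} \<in> X)\<^sup>*\<^sup>*"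

lemma distinct_path_if_connected_by:
  assumes "connected_by X i j"
  obtains vs where "vs \<noteq> []" "distinct vs" "hd vs = i" "last vs = j"
    "successively (\<lambda>x y. {x, y} \<in> X) vs"
proof -
  from assms have "\<exists>vs. vs \<noteq> [] \<and> distinct vs \<and> hd vs = i \<and> last vs = j \<and>
    successively (\<lambda>x y. {x, y} \<in> X) vs"
  proof (induction rule: rtranclp_induct)
    case base
    show ?case by (rule exI[of _ "[i]"]) simp
  next
    case (step y z)
    then obtain vs where vs: "vs \<noteq> []" "distinct vs" "hd vs = i" "last vs = y"
      "successively (\<lambda>x y. {x, y} \<in> X) vs" by blast
    show ?case
    proof (cases "z \<in> set vs")
      case True
      then obtain xs ys where "vs = xs @ z # ys" by (meson split_list)
      then show ?thesis
        using vs by (intro exI[of _ "xs @ [z]"]) (auto simp: successively_append_iff hd_append)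
    next
      case False
      then show ?thesis
        using vs step.hyps(2) by (intro exI[of _ "vs @ [z]"]) (auto simp: successively_append_iff)
    qed
  qed
  then show thesis using that by blast
qed

lemma is_cycle_if_edge_bypassed:
  assumes "i \<noteq> j" "{i, j} \<in> X" "connected_by (X - {{i, j}}) i j"
  shows "\<exists>vs. is_cycle X vs"
proof -
  obtain vs where vs: "vs \<noteq> []" "distinct vs" "hd vs = i" "last vs = j"
    and edges: "successively (\<lambda>x y. {x, y} \<in> X - {{i, j}}) vs"
    using distinct_path_if_connected_by assms(3) by metis
  have ends: "vs ! 0 = i" "vs ! (length vs - 1) = j" using vs by (simp_all add: hd_conv_nth last_conv_nth)
  have "length vs \<noteq> 0" "length vs \<noteq> 1" using vs(1) ends assms(1) by auto
  moreover have "length vs \<noteq> 2" using successively_nth[OF edges, of 0] ends by auto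
  ultimately have "length vs \<ge> 3" by linarith
  moreover have "{vs ! m, vs ! (Suc m mod length vs)} \<in> X" if "m < length vs" for m
  proof (cases "Suc m = length vs")
    case True
    then show ?thesis using ends assms(2) by (metis diff_Suc_1 insert_commute mod_self)
  next
    case False
    then show ?thesis using successively_nth[OF edges, of m] that by simp
  qed
  ultimately have "is_cycle X vs" using vs(2) by (simp add: is_cycle_def)
  then show ?thesis ..
qed

lemma edge_bypassed_if_is_cycle:
  assumes "is_cycle X vs"
  obtains i j where "i \<noteq> j" "{i, j} \<in> X" "connected_by (X - {{i, j}}) i j"
proof -
  define n where "n = length vs"
  have n: "n \<ge> 3" "distinct vs" and edge: "\<And>m. m < n \<Longrightarrow> {vs ! m, vs ! (Suc m mod n)} \<in> X"
    using assms by (auto simp: is_cycle_def n_def)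
  let ?i = "vs ! 0" and ?j = "vs ! (n - 1)"
  have vs_eq: "vs ! a = vs ! b \<longleftrightarrow> a = b" if "a < n" "b < n" for a b
    using n(2) that by (simp add: nth_eq_iff_index_eq n_def)
  have "connected_by (X - {{?i, ?j}}) ?i (vs ! m)" if "m < n" for m
    using that
  proof (induction m)
    case (Suc m)
    have "vs ! m \<noteq> ?j" using vs_eq[of m "n - 1"] Suc.prems by simp
    moreover have "vs ! m \<noteq> ?i \<or> vs ! Suc m \<noteq> ?j"
      using vs_eq[of m 0] vs_eq[of "Suc m" "n - 1"] n(1) Suc.prems by auto
    ultimately have "{vs ! m, vs ! Suc m} \<noteq> {?i, ?j}" by (simp add: doubleton_eq_iff)
    then have "{vs ! m, vs ! Suc m} \<in> X - {{?i, ?j}}" using edge[of m] Suc.prems by simp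
    with Suc show ?case by (simp add: rtranclp.rtrancl_into_rtrancl)
  qed simp
  moreover have "{?i, ?j} \<in> X" "?i \<noteq> ?j"
    using edge[of "n - 1"] vs_eq[of 0 "n - 1"] n(1) by (simp_all add: insert_commute)
  ultimately show thesis using that[of ?i ?j] n(1) by simp
qed

definition arc_vectors :: "'v::finite set set \<Rightarrow> (real ^ 'v) set" where
  "arc_vectors E = {axis i 1 - axis j 1 | i j. {i, j} \<in> E}"

definition vec_support :: "real ^ 'v::finite \<Rightarrow> 'v set" where
  "vec_support x = {k. x $ k \<noteq> 0}"

definition cut_sum :: "'v::finite set \<Rightarrow> real ^ 'v \<Rightarrow> real" where
  "cut_sum S x = (\<Sum>k\<in>S. x $ k)"

lemma arc_vectorsE:
  assumes "simple_graph E" "x \<in> arc_vectors E"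
  obtains i j where "i \<noteq> j" "{i, j} \<in> E" "x = axis i 1 - axis j 1"
proof -
  obtain i j where ij: "{i, j} \<in> E" "x = axis i 1 - axis j 1"
    using assms(2) by (auto simp: arc_vectors_def)
  then have "i \<noteq> j" using assms(1) by (auto simp: simple_graph_def)
  with ij show thesis by (rule that[rotated])
qed

lemma arc_vectors_minus: "x \<in> arc_vectors E \<Longrightarrow> - x \<in> arc_vectors E"
  unfolding arc_vectors_def mem_Collect_eq by (metis insert_commute minus_diff_eq)

lemma arc_vectors_mono: "X \<subseteq> Y \<Longrightarrow> arc_vectors X \<subseteq> arc_vectors Y"
  by (auto simp: arc_vectors_def)

lemma finite_arc_vectors: "finite (arc_vectors E)"
proof -
  have "arc_vectors E \<subseteq> range (\<lambda>(i, j). axis i 1 - axis j 1)" by (auto simp: arc_vectors_def)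
  then show ?thesis by (rule finite_subset) simp
qed

lemma vec_support_arc:
  "i \<noteq> j \<Longrightarrow> vec_support (axis i 1 - axis j 1) = {i, j}"
  by (auto simp: vec_support_def axis_def)

lemma vec_support_minus: "vec_support (- x) = vec_support x"
  by (simp add: vec_support_def)

lemma vec_support_arc_vectors:
  assumes "simple_graph E"
  shows "vec_support ` arc_vectors E = E"
proof
  show "vec_support ` arc_vectors E \<subseteq> E"
    using arc_vectorsE[OF assms] vec_support_arc by (metis image_subsetI)
  show "E \<subseteq> vec_support ` arc_vectors E"
  proof
    fix e assume "e \<in> E"
    then obtain i j where ij: "e = {i, j}" "i \<noteq> j"
      using assms unfolding simple_graph_def by (meson card_2_iff)
    then have "axis i 1 - axis j 1 \<in> arc_vectors E"
      using \<open>e \<in> E\<close> unfolding arc_vectors_def by blast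
    then show "e \<in> vec_support ` arc_vectors E" using ij vec_support_arc by blast
  qed
qed

lemma equal_up_to_sign_if_vec_support_eq:
  assumes "simple_graph E" "x \<in> arc_vectors E" "y \<in> arc_vectors E" "vec_support x = vec_support y"
  shows "x = y \<or> x = - y"
proof -
  obtain i j where "i \<noteq> j" "{i, j} \<in> E" "x = axis i 1 - axis j 1"
    by (rule arc_vectorsE[OF assms(1,2)])
  moreover obtain k l where "k \<noteq> l" "{k, l} \<in> E" "y = axis k 1 - axis l 1"
    by (rule arc_vectorsE[OF assms(1,3)])
  ultimately show ?thesis using assms(4) by (auto simp: vec_support_arc doubleton_eq_iff)
qed

lemma linear_cut_sum: "linear (cut_sum S)"
  by (rule linearI) (simp_all add: cut_sum_def sum.distrib sum_distrib_left)

lemma cut_sum_arc: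
  "cut_sum S (axis i 1 - axis j 1) = (if i \<in> S then 1 else 0) - (if j \<in> S then 1 else 0)"
proof -
  have "(\<Sum>k\<in>S. (axis i (1::real)) $ k) = (if i \<in> S then 1 else 0)" for i
    by (simp add: axis_def if_distrib cong: if_cong)
  then show ?thesis by (simp add: cut_sum_def sum_subtractf)
qed

lemma separating_cut_if_not_connected_by:
  assumes "\<not> connected_by E i j"
  obtains S where "cut_sum S (axis i 1 - axis j 1) = 1" "\<And>x. x \<in> arc_vectors E \<Longrightarrow> cut_sum S x = 0"
proof (rule that)
  let ?S = "{k. connected_by E i k}"
  show "cut_sum ?S (axis i 1 - axis j 1) = 1" using assms by (simp add: cut_sum_arc)
  have "k \<in> ?S \<longleftrightarrow> l \<in> ?S" if "{k, l} \<in> E" for k l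
    using that by (auto simp: insert_commute intro: rtranclp.rtrancl_into_rtrancl)
  then show "cut_sum ?S x = 0" if "x \<in> arc_vectors E" for x
    using that by (auto simp: arc_vectors_def cut_sum_arc)
qed

lemma arc_in_span_iff:
  "axis i 1 - axis j 1 \<in> span (arc_vectors E) \<longleftrightarrow> connected_by E i j"
proof
  assume arc: "axis i 1 - axis j 1 \<in> span (arc_vectors E)"
  show "connected_by E i j"
  proof (rule ccontr)
    assume "\<not> connected_by E i j"
    then obtain S where "cut_sum S (axis i 1 - axis j 1) = 1"
      "\<And>x. x \<in> arc_vectors E \<Longrightarrow> cut_sum S x = 0"
      by (rule separating_cut_if_not_connected_by) blast
    then show False using linear_eq_0_on_span[OF linear_cut_sum _ arc] by fastforce
  qed
next
  assume "connected_by E i j"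
  then show "axis i 1 - axis j 1 \<in> span (arc_vectors E)"
  proof (induction rule: rtranclp_induct)
    case (step j k)
    have "axis j 1 - axis k 1 \<in> span (arc_vectors E)"
      using step.hyps(2) by (auto simp: arc_vectors_def intro: span_base)
    from span_add[OF step.IH this] show ?case by simp
  qed (simp add: span_zero)
qed

lemma span_eq_span_arc_vectors_support:
  assumes "simple_graph E" "C \<subseteq> arc_vectors E"
  shows "span C = span (arc_vectors (vec_support ` C))"
proof -
  have "x \<in> span C" if x: "x \<in> arc_vectors (vec_support ` C)" for x
  proof -
    have supp: "vec_support ` C \<subseteq> E" using assms vec_support_arc_vectors by blast
    then have "simple_graph (vec_support ` C)" using assms(1) by (auto simp: simple_graph_def)
    then obtain c where c: "c \<in> C" "vec_support x = vec_support c"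
      using vec_support_arc_vectors x by blast
    then have "x = c \<or> x = - c"
      using equal_up_to_sign_if_vec_support_eq[OF assms(1)] x arc_vectors_mono[OF supp] assms(2) by blast
    then show ?thesis using c(1) by (auto intro: span_base span_neg)
  qed
  moreover have "C \<subseteq> arc_vectors (vec_support ` C)"
  proof
    fix c assume "c \<in> C"
    then have "c \<in> arc_vectors E" using assms(2) by blast
    then obtain i j where ij: "i \<noteq> j" "{i, j} \<in> E" "c = axis i 1 - axis j 1"
      by (rule arc_vectorsE[OF assms(1)])
    then have "{i, j} \<in> vec_support ` C" using \<open>c \<in> C\<close> vec_support_arc by (metis imageI)
    then show "c \<in> arc_vectors (vec_support ` C)" using ij(3) by (auto simp: arc_vectors_def)
  qed
  ultimately show ?thesis by (auto simp: span_eq intro: span_base)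
qed

lemma arc_in_span_remaining_iff:
  assumes E: "simple_graph E" and B: "B \<subseteq> arc_vectors E" "inj_on vec_support B"
    and x: "x \<in> B" "vec_support x = {i, j}" and "i \<noteq> j"
  shows "x \<in> span (B - {x}) \<longleftrightarrow> connected_by (vec_support ` B - {{i, j}}) i j"
proof -
  let ?a = "axis i 1 - axis j 1"
  have "vec_support ` (B - {x}) = vec_support ` B - {{i, j}}"
    using inj_on_image_set_diff[OF B(2), of B "{x}"] x by simp
  then have span: "span (B - {x}) = span (arc_vectors (vec_support ` B - {{i, j}}))"
    using span_eq_span_arc_vectors_support[OF E, of "B - {x}"] B(1) by auto
  have "{i, j} \<in> E" using vec_support_arc_vectors[OF E] B(1) x by blast
  then have "?a \<in> arc_vectors E" by (auto simp: arc_vectors_def)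
  then have "x = ?a \<or> x = - ?a"
    using equal_up_to_sign_if_vec_support_eq[OF E, of x ?a] B(1) x vec_support_arc[OF \<open>i \<noteq> j\<close>] by auto
  then have "x \<in> span (B - {x}) \<longleftrightarrow> ?a \<in> span (B - {x})" by (metis minus_minus span_neg)
  then show ?thesis unfolding span by (simp only: arc_in_span_iff)
qed

lemma forest_iff_independent:
  assumes E: "simple_graph E" and B: "B \<subseteq> arc_vectors E" "inj_on vec_support B"
  shows "(\<nexists>vs. is_cycle (vec_support ` B) vs) \<longleftrightarrow> independent B"
proof safe
  fix vs assume "independent B" "is_cycle (vec_support ` B) vs"
  from this(2) obtain i j where ij: "i \<noteq> j" "{i, j} \<in> vec_support ` B"
    and bypass: "connected_by (vec_support ` B - {{i, j}}) i j"
    by (rule edge_bypassed_if_is_cycle)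
  then obtain x where x: "x \<in> B" "vec_support x = {i, j}" by fastforce
  then have "x \<in> span (B - {x})" using arc_in_span_remaining_iff[OF E B] ij(1) bypass by blast
  then show False using \<open>independent B\<close> x(1) by (auto simp: dependent_def)
next
  assume acyclic: "\<nexists>vs. is_cycle (vec_support ` B) vs" and "dependent B"
  then obtain x where x: "x \<in> B" "x \<in> span (B - {x})" by (auto simp: dependent_def)
  then have "x \<in> arc_vectors E" using B(1) by blast
  then obtain i j where ij: "i \<noteq> j" "{i, j} \<in> E" "x = axis i 1 - axis j 1"
    by (rule arc_vectorsE[OF E])
  then have "connected_by (vec_support ` B - {{i, j}}) i j"
    using arc_in_span_remaining_iff[OF E B] x by (simp add: vec_support_arc)
  moreover have "{i, j} \<in> vec_support ` B" using x(1) ij by (metis imageI vec_support_arc)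
  ultimately show False using is_cycle_if_edge_bypassed[OF ij(1)] acyclic by blast
qed

lemma representation_eq_cut_sum:
  assumes "simple_graph E" "B \<subseteq> arc_vectors E" "independent B" "b \<in> B"
  obtains S where "\<And>v. v \<in> span B \<Longrightarrow> representation B v b = cut_sum S v"
proof -
  have "b \<in> arc_vectors E" using assms(2,4) by blast
  then obtain i j where ij: "i \<noteq> j" "{i, j} \<in> E" "b = axis i 1 - axis j 1"
    by (rule arc_vectorsE[OF assms(1)])
  let ?R = "vec_support ` (B - {b})"
  have "B - {b} \<subseteq> arc_vectors E" using assms(2) by blast
  then have span: "span (B - {b}) = span (arc_vectors ?R)"
    by (rule span_eq_span_arc_vectors_support[OF assms(1)])
  have "b \<notin> span (B - {b})" using assms(3,4) by (auto simp: dependent_def)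
  then have "axis i 1 - axis j 1 \<notin> span (arc_vectors ?R)" using span ij(3) by simp
  then have "\<not> connected_by ?R i j" by (simp only: arc_in_span_iff not_False_eq_True)
  then obtain S where "cut_sum S (axis i 1 - axis j 1) = 1"
    and S: "\<And>x. x \<in> arc_vectors ?R \<Longrightarrow> cut_sum S x = 0"
    by (rule separating_cut_if_not_connected_by) blast
  then have "cut_sum S b = 1" using ij(3) by simp
  have "cut_sum S x = 0" if "x \<in> B - {b}" for x
    using linear_eq_0_on_span[OF linear_cut_sum S] span_base[OF that] span by simp
  then show thesis
    using representation_eq_functional[OF assms(3,4) _ linear_cut_sum \<open>cut_sum S b = 1\<close>] that by blast
qed

lemma unimodular_arc_vectors:
  assumes "simple_graph E"
  shows "unimodular (arc_vectors E)"
  unfolding unimodular_def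
proof (intro allI impI ballI)
  fix T v t assume T: "T \<subseteq> arc_vectors E" and v: "v \<in> arc_vectors E"
  show "representation T v t \<in> {-1, 0, 1}"
  proof (cases "representation T v t = 0")
    case False
    then have "independent T" "t \<in> T" "v \<in> span T"
      using representation_nonzeroD by blast+
    then obtain S where "representation T v t = cut_sum S v"
      using representation_eq_cut_sum[OF assms T] by metis
    moreover obtain i j where "i \<noteq> j" "{i, j} \<in> E" "v = axis i 1 - axis j 1"
      by (rule arc_vectorsE[OF assms v])
    ultimately show ?thesis by (simp add: cut_sum_arc)
  qed simp
qed

lemma integral_iff_representation_integral:
  assumes E: "simple_graph E" and B: "B \<subseteq> arc_vectors E" "independent B" and "x \<in> span B"
  shows "(\<forall>k. x $ k \<in> \<int>) \<longleftrightarrow> (\<forall>b\<in>B. representation B x b \<in> \<int>)"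
proof safe
  fix b assume x: "\<forall>k. x $ k \<in> \<int>" and "b \<in> B"
  then obtain S where "representation B x b = cut_sum S x"
    using representation_eq_cut_sum[OF E B] \<open>x \<in> span B\<close> by metis
  then show "representation B x b \<in> \<int>" using x by (simp add: cut_sum_def Ints_sum)
next
  fix k assume coeff: "\<forall>b\<in>B. representation B x b \<in> \<int>"
  have "finite B" using B(1) finite_arc_vectors finite_subset by blast
  then have "x $ k = (\<Sum>b\<in>B. representation B x b *\<^sub>R b) $ k"
    using sum_representation_eq[OF B(2) \<open>x \<in> span B\<close>] by simp
  also have "\<dots> = (\<Sum>b\<in>B. representation B x b * b $ k)" by simp
  also have "\<dots> \<in> \<int>"
    using coeff B(1) by (auto simp: arc_vectors_def axis_def intro!: Ints_sum Ints_mult)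
  finally show "x $ k \<in> \<int>" .
qed

section \<open>Orientations and matroid isomorphisms\<close>

definition vector_matroid :: "'a::real_vector set \<Rightarrow> 'a matroid" where
  "vector_matroid V = \<lparr>ground = V, indep = (\<lambda>X. X \<subseteq> V \<and> independent X)\<rparr>"

definition orientation :: "(real ^ 'v) set \<Rightarrow> 'v::finite set set \<Rightarrow> bool" where
  "orientation B E \<longleftrightarrow> B \<subseteq> arc_vectors E \<and> bij_betw vec_support B E"

lemma ex_orientation:
  assumes "simple_graph E"
  shows "\<exists>B. orientation B E"
proof -
  have "E \<subseteq> vec_support ` arc_vectors E" using vec_support_arc_vectors[OF assms] by simp
  then obtain B where "B \<subseteq> arc_vectors E" "inj_on vec_support B" "E = vec_support ` B"
    unfolding subset_image_inj by blast
  then have "orientation B E" by (simp add: orientation_def bij_betw_def)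
  then show ?thesis ..
qed

lemma arc_vectors_eq_orientation:
  assumes "simple_graph E" "orientation B E"
  shows "arc_vectors E = B \<union> uminus ` B"
proof
  have B: "B \<subseteq> arc_vectors E" "vec_support ` B = E"
    using assms(2) by (auto simp: orientation_def bij_betw_def)
  show "arc_vectors E \<subseteq> B \<union> uminus ` B"
  proof
    fix x assume x: "x \<in> arc_vectors E"
    then obtain b where b: "b \<in> B" "vec_support x = vec_support b"
      using B(2) vec_support_arc_vectors[OF assms(1)] by blast
    then have "x = b \<or> x = - b"
      using equal_up_to_sign_if_vec_support_eq[OF assms(1) x] B(1) by blast
    then show "x \<in> B \<union> uminus ` B" using b(1) by blast
  qed
  show "B \<union> uminus ` B \<subseteq> arc_vectors E" using B(1) arc_vectors_minus by auto
qed

lemma matroid_isomorphic_sym: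
  assumes "matroid_isomorphic M N"
  shows "matroid_isomorphic N M"
proof -
  obtain \<phi> where \<phi>: "bij_betw \<phi> (ground M) (ground N)"
    and indep: "\<And>X. X \<subseteq> ground M \<Longrightarrow> indep M X \<longleftrightarrow> indep N (\<phi> ` X)"
    using assms unfolding matroid_isomorphic_def by blast
  let ?\<psi> = "the_inv_into (ground M) \<phi>"
  have \<psi>: "bij_betw ?\<psi> (ground N) (ground M)" using \<phi> by (rule bij_betw_the_inv_into)
  have "indep N Y \<longleftrightarrow> indep M (?\<psi> ` Y)" if "Y \<subseteq> ground N" for Y
  proof -
    have "\<phi> ` ?\<psi> ` Y = Y"
      using that f_the_inv_into_f_bij_betw[OF \<phi>] by (force simp: image_image)
    moreover have "?\<psi> ` Y \<subseteq> ground M" using \<psi> that bij_betw_imp_surj_on by blast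
    ultimately show ?thesis using indep by metis
  qed
  then show ?thesis using \<psi> unfolding matroid_isomorphic_def by blast
qed

lemma matroid_isomorphic_trans:
  assumes "matroid_isomorphic L M" "matroid_isomorphic M N"
  shows "matroid_isomorphic L N"
proof -
  obtain \<phi> \<psi> where \<phi>: "bij_betw \<phi> (ground L) (ground M)"
    "\<And>X. X \<subseteq> ground L \<Longrightarrow> indep L X \<longleftrightarrow> indep M (\<phi> ` X)"
    and \<psi>: "bij_betw \<psi> (ground M) (ground N)"
    "\<And>X. X \<subseteq> ground M \<Longrightarrow> indep M X \<longleftrightarrow> indep N (\<psi> ` X)"
    using assms unfolding matroid_isomorphic_def by blast
  have "indep L X \<longleftrightarrow> indep N ((\<psi> \<circ> \<phi>) ` X)" if "X \<subseteq> ground L" for X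
  proof -
    have "\<phi> ` X \<subseteq> ground M" using \<phi>(1) that bij_betw_imp_surj_on by blast
    then show ?thesis using \<phi>(2)[OF that] \<psi>(2) by (simp add: image_comp)
  qed
  then show ?thesis
    using bij_betw_trans[OF \<phi>(1) \<psi>(1)] unfolding matroid_isomorphic_def by blast
qed

lemma vector_matroid_isomorphic_iff:
  "matroid_isomorphic (vector_matroid V) (vector_matroid W) \<longleftrightarrow>
    (\<exists>\<phi>. \<phi> ` V = W \<and> independence_preserving \<phi> V)"
proof -
  have "bij_betw \<phi> V W \<and>
      (\<forall>X\<subseteq>V. indep (vector_matroid V) X \<longleftrightarrow> indep (vector_matroid W) (\<phi> ` X)) \<longleftrightarrow>
    \<phi> ` V = W \<and> independence_preserving \<phi> V" for \<phi>
  proof (cases "\<phi> ` V = W")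
    case True
    then have "\<phi> ` X \<subseteq> W" if "X \<subseteq> V" for X using that by blast
    with True show ?thesis
      by (auto simp: vector_matroid_def bij_betw_def independence_preserving_def)
  qed (simp add: bij_betw_def)
  then show ?thesis by (simp add: matroid_isomorphic_def vector_matroid_def)
qed

lemma vector_matroid_orientation_isomorphic:
  assumes E: "simple_graph E" and "orientation B E"
  shows "matroid_isomorphic (vector_matroid B) (graphic_matroid E)"
proof -
  have B: "B \<subseteq> arc_vectors E" "bij_betw vec_support B E"
    using assms(2) by (auto simp: orientation_def)
  have "indep (vector_matroid B) X \<longleftrightarrow> indep (graphic_matroid E) (vec_support ` X)" if "X \<subseteq> B" for X
  proof -
    have "inj_on vec_support X" "vec_support ` X \<subseteq> E"
      using B(2) that inj_on_subset[of vec_support B X] by (auto simp: bij_betw_def)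
    then show ?thesis
      using forest_iff_independent[OF E, of X] B(1) that
      by (simp add: vector_matroid_def graphic_matroid_def)
  qed
  moreover have "ground (vector_matroid B) = B" "ground (graphic_matroid E) = E"
    by (simp_all add: vector_matroid_def graphic_matroid_def)
  ultimately show ?thesis using B(2) unfolding matroid_isomorphic_def by metis
qed

lemma graphic_matroid_isomorphic_iff_orientations:
  assumes "simple_graph G" "orientation B G" "simple_graph H" "orientation C H"
  shows "matroid_isomorphic (graphic_matroid G) (graphic_matroid H) \<longleftrightarrow>
    matroid_isomorphic (vector_matroid B) (vector_matroid C)"
proof -
  have "matroid_isomorphic (vector_matroid B) (graphic_matroid G)"
    and "matroid_isomorphic (vector_matroid C) (graphic_matroid H)"
    using assms by (simp_all add: vector_matroid_orientation_isomorphic)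
  then show ?thesis by (meson matroid_isomorphic_sym matroid_isomorphic_trans)
qed

definition span_isomorphism ::
    "('a::real_vector \<Rightarrow> 'b::real_vector) \<Rightarrow> 'a set \<Rightarrow> 'b set \<Rightarrow> bool" where
  "span_isomorphism L V W \<longleftrightarrow> linear L \<and> inj_on L (span V) \<and> L ` V = W"

lemma span_isomorphismD:
  assumes "span_isomorphism L V W"
  shows "linear L" "inj_on L (span V)" "L ` V = W"
  using assms by (simp_all add: span_isomorphism_def)

lemma span_isomorphism_symmetric_closure:
  assumes L: "extends_up_to_sign L \<phi> V" and \<phi>: "independence_preserving \<phi> V"
  shows "span_isomorphism L (V \<union> uminus ` V) (\<phi> ` V \<union> uminus ` \<phi> ` V)"
proof -
  note linear_L = extends_up_to_signD(1)[OF L]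
  have "V \<union> uminus ` V \<subseteq> span V" by (auto intro: span_base span_neg)
  then have "span (V \<union> uminus ` V) \<subseteq> span V" by (simp add: span_minimal)
  then have "inj_on L (span (V \<union> uminus ` V))"
    using inj_on_subset[OF inj_on_span_extends_up_to_sign[OF L \<phi>]] by blast
  moreover have "L ` (V \<union> uminus ` V) = \<phi> ` V \<union> uminus ` \<phi> ` V"
  proof -
    have "L ` {v, - v} = {\<phi> v, - \<phi> v}" if "v \<in> V" for v
      using extends_up_to_signD(2)[OF L that] linear_neg[OF linear_L] by auto
    then have "(\<Union>v\<in>V. L ` {v, - v}) = (\<Union>v\<in>V. {\<phi> v, - \<phi> v})" by simp
    moreover have "L ` (V \<union> uminus ` V) = (\<Union>v\<in>V. L ` {v, - v})" by auto
    moreover have "\<phi> ` V \<union> uminus ` \<phi> ` V = (\<Union>v\<in>V. {\<phi> v, - \<phi> v})" by auto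
    ultimately show ?thesis by simp
  qed
  ultimately show ?thesis using linear_L by (simp add: span_isomorphism_def)
qed

lemma orientation_linear_image:
  assumes G: "simple_graph G" "orientation B G" and "simple_graph H"
    and iso: "span_isomorphism L (arc_vectors G) (arc_vectors H)"
  shows "orientation (L ` B) H"
proof -
  note L = span_isomorphismD[OF iso]
  have B: "B \<subseteq> arc_vectors G" "inj_on vec_support B"
    using G(2) by (auto simp: orientation_def bij_betw_def)
  have "inj_on vec_support (L ` B)"
  proof (rule inj_onI)
    fix y y' assume y: "y \<in> L ` B" "y' \<in> L ` B" and supp: "vec_support y = vec_support y'"
    then obtain b b' where b: "b \<in> B" "b' \<in> B" "y = L b" "y' = L b'" by blast
    have "y = y' \<or> y = - y'"
      using equal_up_to_sign_if_vec_support_eq[OF \<open>simple_graph H\<close>] supp y B(1) L(3) by blast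
    then have "L b = L b' \<or> L b = L (- b')" by (simp add: b linear_neg[OF L(1)])
    moreover have "b \<in> span (arc_vectors G)" "b' \<in> span (arc_vectors G)"
      using b(1,2) B(1) span_base by blast+
    ultimately have "b = b' \<or> b = - b'" using inj_onD[OF L(2)] span_neg by metis
    then have "vec_support b = vec_support b'" using vec_support_minus by metis
    then show "y = y'" using inj_onD[OF B(2)] b by blast
  qed
  moreover have "vec_support ` L ` B = H"
  proof -
    have "arc_vectors H = L ` B \<union> uminus ` L ` B"
      unfolding L(3)[symmetric] arc_vectors_eq_orientation[OF G] image_Un
      by (simp add: image_image linear_neg[OF L(1)])
    then have "vec_support ` arc_vectors H = vec_support ` L ` B"
      by (simp add: image_Un image_image vec_support_minus)
    then show ?thesis using vec_support_arc_vectors[OF \<open>simple_graph H\<close>] by simp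
  qed
  moreover have "L ` B \<subseteq> arc_vectors H" using B(1) L(3) by blast
  ultimately show ?thesis by (simp add: orientation_def bij_betw_def)
qed

lemma span_isomorphism_if_graphic_matroid_isomorphic:
  assumes G: "simple_graph G" and H: "simple_graph H"
    and iso: "matroid_isomorphic (graphic_matroid G) (graphic_matroid H)"
  shows "\<exists>L. span_isomorphism L (arc_vectors G) (arc_vectors H)"
proof -
  obtain B where B: "orientation B G" using ex_orientation[OF G] by blast
  obtain C where C: "orientation C H" using ex_orientation[OF H] by blast
  have sub: "B \<subseteq> arc_vectors G" "C \<subseteq> arc_vectors H" using B C by (simp_all add: orientation_def)
  obtain \<phi> where \<phi>: "\<phi> ` B = C" "independence_preserving \<phi> B"
    using iso graphic_matroid_isomorphic_iff_orientations[OF G B H C]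
    by (auto simp: vector_matroid_isomorphic_iff)
  have "finite B" using sub(1) finite_arc_vectors finite_subset by blast
  moreover have "unimodular B" "unimodular (\<phi> ` B)"
    unfolding \<phi>(1) using unimodular_arc_vectors[OF G] unimodular_arc_vectors[OF H] sub
    by (simp_all add: unimodular_mono)
  ultimately obtain L where L: "extends_up_to_sign L \<phi> B"
    using unimodular_unique_representation \<phi>(2) by blast
  have "span_isomorphism L (arc_vectors G) (arc_vectors H)"
    using span_isomorphism_symmetric_closure[OF L \<phi>(2)]
    unfolding arc_vectors_eq_orientation[OF G B] arc_vectors_eq_orientation[OF H C] \<phi>(1) .
  then show ?thesis by (intro exI)
qed

lemma graphic_matroid_isomorphic_if_span_isomorphism:
  assumes G: "simple_graph G" and H: "simple_graph H"
    and iso: "span_isomorphism L (arc_vectors G) (arc_vectors H)"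
  shows "matroid_isomorphic (graphic_matroid G) (graphic_matroid H)"
proof -
  obtain B where B: "orientation B G" using ex_orientation[OF G] by blast
  then have "B \<subseteq> arc_vectors G" by (simp add: orientation_def)
  then have "independence_preserving L B"
    using independence_preserving_linear[OF span_isomorphismD(1,2)[OF iso]]
    by (rule independence_preserving_mono[rotated])
  then show ?thesis
    using graphic_matroid_isomorphic_iff_orientations[OF G B H orientation_linear_image[OF G B H iso]]
    by (auto simp: vector_matroid_isomorphic_iff)
qed

section \<open>Unimodular equivalences\<close>

lemma symmetric_edge_polytope_eq: "symmetric_edge_polytope E = convex hull (arc_vectors E)"
proof -
  have "{x. \<exists>i j. {i, j} \<in> E \<and> (x = axis i 1 - axis j 1 \<or> x = - (axis i 1 - axis j 1))} =
      arc_vectors E \<union> uminus ` arc_vectors E"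
    unfolding arc_vectors_def by blast
  also have "\<dots> = arc_vectors E" using arc_vectors_minus by blast
  finally show ?thesis by (simp add: symmetric_edge_polytope_def)
qed

lemma extreme_points_convex_hull_subset_sphere:
  fixes V :: "'a::euclidean_space set"
  assumes "V \<subseteq> sphere a r"
  shows "{x. x extreme_point_of (convex hull V)} = V"
proof
  show "{x. x extreme_point_of (convex hull V)} \<subseteq> V" by (rule extreme_points_of_convex_hull)
  have hull: "convex hull V \<subseteq> cball a r" using assms by (intro hull_minimal) auto
  have "x \<notin> open_segment y z" if "x \<in> V" "y \<in> convex hull V" "z \<in> convex hull V" for x y z
  proof
    assume "x \<in> open_segment y z"
    then have "dist a x < dist a y \<or> dist a x < dist a z" by (rule dist_decreases_open_segment)
    moreover have "dist a x = r" "dist a y \<le> r" "dist a z \<le> r" using assms hull that by auto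
    ultimately show False by linarith
  qed
  then show "V \<subseteq> {x. x extreme_point_of (convex hull V)}"
    by (auto simp: extreme_point_of_def hull_inc)
qed

lemma extreme_points_arc_vectors:
  assumes "simple_graph E"
  shows "{x. x extreme_point_of (convex hull arc_vectors E)} = arc_vectors E"
proof (rule extreme_points_convex_hull_subset_sphere)
  show "arc_vectors E \<subseteq> sphere 0 (sqrt 2)"
  proof
    fix x assume "x \<in> arc_vectors E"
    then obtain i j where "i \<noteq> j" "{i, j} \<in> E" "x = axis i 1 - axis j 1" by (rule arc_vectorsE[OF assms])
    then have "x \<bullet> x = 2" by (simp add: inner_diff_left inner_diff_right inner_axis_axis)
    then show "x \<in> sphere 0 (sqrt 2)" by (simp add: norm_eq_sqrt_inner)
  qed
qed

lemma affine_map_onD: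
  "affine_map_on S f \<Longrightarrow> x \<in> S \<Longrightarrow> y \<in> S \<Longrightarrow> a + b = 1 \<Longrightarrow>
    f (a *\<^sub>R x + b *\<^sub>R y) = a *\<^sub>R f x + b *\<^sub>R f y"
  by (simp add: affine_map_on_def)

lemma affine_map_on_open_segment_iff:
  assumes f: "affine_map_on S f" "inj_on f S" and P: "P \<subseteq> S" "convex P"
    and "x \<in> P" "a \<in> P" "b \<in> P"
  shows "f x \<in> open_segment (f a) (f b) \<longleftrightarrow> x \<in> open_segment a b"
proof -
  have f_eq: "f y = f z \<longleftrightarrow> y = z" if "y \<in> P" "z \<in> P" for y z
    using inj_on_eq_iff[OF f(2)] P(1) that by blast
  have "f x = (1 - t) *\<^sub>R f a + t *\<^sub>R f b \<longleftrightarrow> x = (1 - t) *\<^sub>R a + t *\<^sub>R b" if "0 < t" "t < 1" for t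
  proof -
    have "(1 - t) *\<^sub>R a + t *\<^sub>R b \<in> P" using convexD[OF P(2)] assms(6,7) that by simp
    moreover have "f ((1 - t) *\<^sub>R a + t *\<^sub>R b) = (1 - t) *\<^sub>R f a + t *\<^sub>R f b"
      using affine_map_onD[OF f(1)] assms(6,7) P(1) by (simp add: subset_iff)
    ultimately show ?thesis using f_eq \<open>x \<in> P\<close> by metis
  qed
  then show ?thesis using f_eq[OF assms(6,7)] unfolding in_segment by blast
qed

lemma affine_map_on_extreme_points:
  assumes "affine_map_on S f" "inj_on f S" "P \<subseteq> S" "convex P"
  shows "f ` {x. x extreme_point_of P} = {y. y extreme_point_of (f ` P)}"
proof -
  have "f x extreme_point_of (f ` P) \<longleftrightarrow> x extreme_point_of P" if "x \<in> P" for x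
    using affine_map_on_open_segment_iff[OF assms that] that by (simp add: extreme_point_of_def)
  then show ?thesis by (auto simp: extreme_point_of_def)
qed

lemma affine_map_on_span:
  fixes f :: "'a::real_vector \<Rightarrow> 'b::real_vector"
  assumes aff: "affine_map_on (span V) f"
  obtains L where "linear L" "\<And>x. x \<in> span V \<Longrightarrow> f x = L x + f 0"
proof -
  define g where "g x = f x - f 0" for x
  have g_scale: "g (c *\<^sub>R x) = c *\<^sub>R g x" if "x \<in> span V" for c x
    using affine_map_onD[OF aff that span_zero, of c "1 - c"]
    by (simp add: g_def algebra_simps)
  have g_add: "g (x + y) = g x + g y" if "x \<in> span V" "y \<in> span V" for x y
  proof -
    have "f ((1/2) *\<^sub>R (2 *\<^sub>R x) + (1/2) *\<^sub>R (2 *\<^sub>R y)) = (1/2) *\<^sub>R f (2 *\<^sub>R x) + (1/2) *\<^sub>R f (2 *\<^sub>R y)"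
      by (rule affine_map_onD[OF aff]) (use that in \<open>auto intro: span_scale\<close>)
    then have "g (x + y) = (1/2) *\<^sub>R g (2 *\<^sub>R x) + (1/2) *\<^sub>R g (2 *\<^sub>R y)"
      by (simp add: g_def algebra_simps flip: scaleR_left_distrib)
    then show ?thesis using g_scale that by simp
  qed
  obtain B where B: "B \<subseteq> V" "independent B" "span B = span V"
    by (rule independent_spanning_subset)
  obtain L where L: "linear L" "\<forall>b\<in>B. L b = g b"
    using linear_independent_extend[OF B(2), of g] by blast
  have "x \<in> span V \<and> g x = L x" if "x \<in> span B" for x
    using that
  proof (induction rule: span_induct_alt)
    case base
    show ?case by (simp add: g_def span_zero linear_0[OF L(1)])
  next
    case (step c b y)
    then show ?case
      using L g_add g_scale
      by (simp add: span_base span_add span_scale linear_add linear_scale flip: B(3))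
  qed
  then have "f x = L x + f 0" if "x \<in> span V" for x
    using that by (simp add: B(3) g_def algebra_simps)
  then show thesis using that L(1) by blast
qed

lemma sum_symmetric_set_eq_0:
  fixes V :: "'a::real_vector set"
  assumes "\<And>x. x \<in> V \<Longrightarrow> - x \<in> V"
  shows "(\<Sum>x\<in>V. x) = 0"
proof -
  have "(\<Sum>x\<in>V. x) = (\<Sum>x\<in>V. - x)"
    by (rule sum.reindex_bij_witness[of _ uminus uminus]) (auto simp: assms)
  then have "(\<Sum>x\<in>V. x) + (\<Sum>x\<in>V. x) = 0" unfolding sum_negf by (metis add.right_inverse)
  then have "2 *\<^sub>R (\<Sum>x\<in>V. x) = 0" by (simp only: scaleR_2)
  then show ?thesis by simp
qed

lemma affine_hull_symmetric_set:
  fixes V :: "'a::real_vector set"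
  assumes "V \<noteq> {}" "\<And>x. x \<in> V \<Longrightarrow> - x \<in> V"
  shows "affine hull V = span V"
proof -
  obtain x where "x \<in> V" using assms(1) by blast
  then have "midpoint x (- x) \<in> affine hull V"
    unfolding midpoint_def scaleR_right_distrib
    by (intro mem_affine affine_affine_hull hull_inc assms(2)) auto
  then have "0 \<in> affine hull V" by (simp add: midpoint_def)
  then show ?thesis by (rule affine_hull_span_0)
qed

lemma affine_hull_arc_vectors:
  assumes "arc_vectors E \<noteq> {}"
  shows "affine hull (convex hull arc_vectors E) = span (arc_vectors E)"
  unfolding affine_hull_convex_hull
  using assms arc_vectors_minus by (rule affine_hull_symmetric_set)

lemma affine_map_on_fixes_0:
  fixes f :: "'a::real_vector \<Rightarrow> 'b::real_vector"
  assumes aff: "affine_map_on (span V) f" and V: "finite V" "V \<noteq> {}" "inj_on f V"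
    and sym: "\<And>x. x \<in> V \<Longrightarrow> - x \<in> V" "\<And>y. y \<in> f ` V \<Longrightarrow> - y \<in> f ` V"
  shows "f 0 = 0"
proof -
  obtain L where L: "linear L" "\<And>x. x \<in> span V \<Longrightarrow> f x = L x + f 0"
    using affine_map_on_span[OF aff] by blast
  have "0 = (\<Sum>y\<in>f ` V. y)" using sum_symmetric_set_eq_0[OF sym(2)] by simp
  also have "\<dots> = (\<Sum>x\<in>V. f x)" by (simp add: sum.reindex V(3))
  also have "\<dots> = (\<Sum>x\<in>V. L x + f 0)" by (rule sum.cong) (simp_all add: L(2) span_base)
  also have "\<dots> = L (\<Sum>x\<in>V. x) + real (card V) *\<^sub>R f 0"
    by (simp only: sum.distrib linear_sum[OF L(1)] sum_constant_scaleR)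
  also have "\<dots> = real (card V) *\<^sub>R f 0"
    by (simp add: sum_symmetric_set_eq_0[OF sym(1)] linear_0[OF L(1)])
  finally show ?thesis using V(1,2) by simp
qed

lemma span_isomorphism_if_unimodularly_equivalent:
  assumes G: "simple_graph G" and H: "simple_graph H"
    and "unimodularly_equivalent (symmetric_edge_polytope G) (symmetric_edge_polytope H)"
  shows "\<exists>L. span_isomorphism L (arc_vectors G) (arc_vectors H)"
proof -
  let ?V = "arc_vectors G" and ?W = "arc_vectors H"
  obtain f where aff: "affine_map_on (affine hull (convex hull ?V)) f"
    and inj: "inj_on f (affine hull (convex hull ?V))" and im: "f ` (convex hull ?V) = convex hull ?W"
    using assms(3) unfolding unimodularly_equivalent_def symmetric_edge_polytope_eq bij_betw_def by blast
  have f_V: "f ` ?V = ?W"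
    using affine_map_on_extreme_points[OF aff inj hull_subset convex_convex_hull]
    by (simp add: im extreme_points_arc_vectors G H)
  show ?thesis
  proof (cases "?V = {}")
    case True
    then have "?W = {}" using f_V by simp
    with True have "span_isomorphism (\<lambda>_. 0) ?V ?W" by (simp add: span_isomorphism_def module_hom_zero)
    then show ?thesis by (intro exI)
  next
    case False
    note span_V = affine_hull_arc_vectors[OF False]
    obtain L where L: "linear L" "\<And>x. x \<in> span ?V \<Longrightarrow> f x = L x + f 0"
      using affine_map_on_span aff unfolding span_V by blast
    have "f 0 = 0"
    proof (rule affine_map_on_fixes_0[of ?V])
      show "inj_on f ?V" using inj unfolding span_V by (rule inj_on_subset) (rule span_superset)
    qed (use aff[unfolded span_V] f_V False in \<open>simp_all add: finite_arc_vectors arc_vectors_minus\<close>)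
    then have f_L: "f x = L x" if "x \<in> span ?V" for x using L(2) that by simp
    have "inj_on L (span ?V)" using inj f_L unfolding span_V by (simp cong: inj_on_cong)
    moreover have "L ` ?V = ?W" using f_V f_L by (simp add: span_base cong: image_cong)
    ultimately have "span_isomorphism L ?V ?W" using L(1) by (simp add: span_isomorphism_def)
    then show ?thesis by (intro exI)
  qed
qed

lemma integral_span_isomorphism_iff:
  assumes G: "simple_graph G" and H: "simple_graph H"
    and iso: "span_isomorphism L (arc_vectors G) (arc_vectors H)"
    and x: "x \<in> span (arc_vectors G)"
  shows "(\<forall>k. L x $ k \<in> \<int>) \<longleftrightarrow> (\<forall>k. x $ k \<in> \<int>)"
proof -
  note L = span_isomorphismD[OF iso]
  obtain B where B: "B \<subseteq> arc_vectors G" "independent B" "span B = span (arc_vectors G)"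
    by (rule independent_spanning_subset)
  have x_B: "x \<in> span B" using x B(3) by simp
  have pres: "independence_preserving L (arc_vectors G)"
    by (rule independence_preserving_linear[OF L(1,2)])
  have ext: "extends_up_to_sign L L (arc_vectors G)" using L(1) by (simp add: extends_up_to_sign_def)
  have LB: "L ` B \<subseteq> arc_vectors H" "independent (L ` B)"
    using B(1,2) L(3) independence_preservingD(2)[OF pres B(1)] by auto
  have "L x \<in> span (L ` B)" using linear_span_image[OF L(1)] x_B by blast
  have "representation (L ` B) (L x) (L b) \<in> \<int> \<longleftrightarrow> representation B x b \<in> \<int>" if "b \<in> B" for b
    using abs_representation_extends_up_to_sign[OF ext pres B(1,2) that x_B]
    by (auto simp: abs_eq_iff)
  then show ?thesis
    using integral_iff_representation_integral[OF G B(1,2) x_B]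
      integral_iff_representation_integral[OF H LB \<open>L x \<in> span (L ` B)\<close>] by simp
qed

lemma unimodularly_equivalent_if_span_isomorphism:
  assumes G: "simple_graph G" and H: "simple_graph H"
    and iso: "span_isomorphism L (arc_vectors G) (arc_vectors H)"
  shows "unimodularly_equivalent (symmetric_edge_polytope G) (symmetric_edge_polytope H)"
proof (cases "arc_vectors G = {}")
  case True
  then have "arc_vectors H = {}" using span_isomorphismD(3)[OF iso] by simp
  with True show ?thesis
    by (simp add: unimodularly_equivalent_def symmetric_edge_polytope_eq affine_map_on_def
        lattice_points_def bij_betw_def)
next
  case False
  let ?V = "arc_vectors G" and ?W = "arc_vectors H"
  note L = span_isomorphismD[OF iso]
  have "?W \<noteq> {}" using False L(3) by blast
  have span_L: "L ` span ?V = span ?W" using linear_span_image[OF L(1)] L(3) by metis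
  then have bij: "bij_betw L (span ?V) (span ?W)" using L(2) by (simp add: bij_betw_def)
  have "L ` lattice_points (span ?V) = lattice_points (span ?W)"
    unfolding lattice_points_def span_L[symmetric]
    using integral_span_isomorphism_iff[OF G H iso] by auto
  then have "bij_betw L (lattice_points (span ?V)) (lattice_points (span ?W))"
    using bij by (rule bij_betw_subset[rotated 2]) (simp add: lattice_points_def)
  moreover have "affine_map_on (span ?V) L"
    by (simp add: affine_map_on_def linear_add[OF L(1)] linear_scale[OF L(1)])
  moreover have "L ` (convex hull ?V) = convex hull ?W"
    using convex_hull_linear_image[OF L(1)] L(3) by metis
  ultimately show ?thesis
    using bij unfolding unimodularly_equivalent_def symmetric_edge_polytope_eq
      affine_hull_arc_vectors[OF False] affine_hull_arc_vectors[OF \<open>?W \<noteq> {}\<close>] by blast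
qed

theorem theorem4p6:
  fixes G :: "'m::finite set set" and H :: "'n::finite set set"
  assumes "simple_graph G" and "simple_graph H"
  shows "unimodularly_equivalent (symmetric_edge_polytope G) (symmetric_edge_polytope H) \<longleftrightarrow>
         matroid_isomorphic (graphic_matroid G) (graphic_matroid H)"
proof
  assume "unimodularly_equivalent (symmetric_edge_polytope G) (symmetric_edge_polytope H)"
  then obtain L where "span_isomorphism L (arc_vectors G) (arc_vectors H)"
    using span_isomorphism_if_unimodularly_equivalent[OF assms] by blast
  then show "matroid_isomorphic (graphic_matroid G) (graphic_matroid H)"
    by (rule graphic_matroid_isomorphic_if_span_isomorphism[OF assms])
next
  assume "matroid_isomorphic (graphic_matroid G) (graphic_matroid H)"
  then obtain L where "span_isomorphism L (arc_vectors G) (arc_vectors H)"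
    using span_isomorphism_if_graphic_matroid_isomorphic[OF assms] by blast
  then show "unimodularly_equivalent (symmetric_edge_polytope G) (symmetric_edge_polytope H)"
    by (rule unimodularly_equivalent_if_span_isomorphism[OF assms])
qed

end
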